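(* The only compact Toeplitz operator on the Hardy space $H^2(\mathbb E)$ of the tetrablock $\mathbb E$ is the zero operator; that is, if $\hat u\in L^\infty(S_{\mathbb E})$ and the Toeplitz operator $T_{\hat u}$ on $H^2(\mathbb E)$ is compact, then $T_{\hat u}=0$.
   Context: The tetrablock is $\mathbb E=\{(z_1,z_2,z_3)\in\mathbb C^3: 1-z_1z-z_2w+z_3zw\neq 0 \text{ for all } z,w\in\overline{\mathbb D}\}$, where $\mathbb D$ is the open unit disc. Its Shilov boundary is $S_{\mathbb E}=\{(z_1,z_2,z_3)\in\mathbb C^3: z_1=\bar z_2z_3,\ |z_3|=1,\ |z_2|\le 1\}$. The type-II Cartan domain of dimension 3 is $\mathfrak R_{\mathrm{II}}=\left\{(z_1,z_2,z_3)\in\mathbb C^3:\left\|\begin{pmatrix} z_1&z_3\\ z_3&z_2\end{pmatrix}\right\|<1\right\}$ (operator norm). Let $S_{\mathfrak R_{\mathrm{II}}}$ be its Shilov boundary (the triples $(z_1,z_2,z_3)\in\mathbb C^3$ for which the matrix $\begin{pmatrix} z_1&z_3\\ z_3&z_2\end{pmatrix}$ is unitary), let $K$ be the group of all linear biholomorphic automorphisms of $\mathfrak R_{\mathrm{II}}$, and let $d\Theta$ be the unique $K$-invariant probability measure supported on $S_{\mathfrak R_{\mathrm{II}}}$. The Hardy space $H^2(\mathfrak R_{\mathrm{II}})$ consists of the holomorphic $f$ on $\mathfrak R_{\mathrm{II}}$ with $\|f\|_{H^2(\mathfrak R_{\mathrm{II}})}=\sup_{0<r<1}\left(\int_{S_{\mathfrak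 R_{\mathrm{II}}}}|f(rz)|^2d\Theta(z)\right)^{1/2}<\infty$. Each such $f$ has a radial limit in $L^2(S_{\mathfrak R_{\mathrm{II}}})=L^2(S_{\mathfrak R_{\mathrm{II}}},d\Theta)$, and taking radial limits embeds $H^2(\mathfrak R_{\mathrm{II}})$ isometrically in $L^2(S_{\mathfrak R_{\mathrm{II}}})$. Let $\phi(z_1,z_2,z_3)=(z_1,z_2,z_1z_2-z_3^2)$. It is a proper holomorphic map of $\mathfrak R_{\mathrm{II}}$ onto $\mathbb E$ with $\phi(S_{\mathfrak R_{\mathrm{II}}})=S_{\mathbb E}$. Let $\mathcal J_\phi$ be the determinant of its Jacobian matrix. Let $d\Theta_{\mathbb E}$ be the measure on $S_{\mathbb E}$ defined by $\int_{S_{\mathbb E}}f\,d\Theta_{\mathbb E}=\frac1C\int_{S_{\mathfrak R_{\mathrm{II}}}}(f\circ\phi)\,|\mathcal J_\phi|^2\,d\Theta$, where $C>0$ is chosen so that $d\Theta_{\mathbb E}$ is a probability measure, and let $L^2(S_{\mathbb E})$, $L^\infty(S_{\mathbb E})$ be the corresponding Lebesgue spaces. The Hardy space of the tetrablock is $H^2(\mathbb E)=\{f \text{ holomorphic on }\mathbb E: \|\mathcal J_\phi\cdot(f\circ\phi)\|_{H^2(\mathfrak R_{\mathrm{II}})}<\infty\}$. Each $f\in H^2(\mathbb E)$ is identified with its boundary value in $L^2(S_{\mathbb E})$, namely the element $\tilde f\in L^2(S_{\mathbb E})$ such that $\mathcal J_\phi\cdot(\tilde f\circ\phi)$ is the radial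 limit of $\mathcal J_\phi\cdot(f\circ\phi)$. In this way $H^2(\mathbb E)$ is a closed subspace of $L^2(S_{\mathbb E})$, with the inherited inner product. Let $P_{H^2(\mathbb E)}$ be the orthogonal projection of $L^2(S_{\mathbb E})$ onto $H^2(\mathbb E)$. For $\hat u\in L^\infty(S_{\mathbb E})$, the Toeplitz operator with symbol $\hat u$ is $T_{\hat u}\hat f=P_{H^2(\mathbb E)}(\hat u\hat f)$, $\hat f\in H^2(\mathbb E)$. *)

theory Defs
  imports "HOL-Analysis.Analysis" "HOL-Probability.Probability"
begin

subsection \<open>Holomorphic maps in several variables\<close>

text \<open>
  Meant for open sets \<open>U\<close> only: the derivative at a point of \<open>U\<close> is a full (unrestricted) one,
  so for open \<open>U\<close> the values of \<open>f\<close> outside \<open>U\<close> are irrelevant.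
\<close>

definition holomorphic_several :: "(complex ^ 'n \<Rightarrow> complex) \<Rightarrow> (complex ^ 'n) set \<Rightarrow> bool" where
  "holomorphic_several f U \<longleftrightarrow>
     (\<forall>z\<in>U. \<exists>f'. (f has_derivative f') (at z) \<and> Vector_Spaces.linear (*s) (*) f')"

definition holomorphic_map :: "(complex ^ 'n \<Rightarrow> complex ^ 'm) \<Rightarrow> (complex ^ 'n) set \<Rightarrow> bool" where
  "holomorphic_map F U \<longleftrightarrow> (\<forall>i. holomorphic_several (\<lambda>z. F z $ i) U)"

definition biholomorphic_automorphism ::
    "(complex ^ 'n) set \<Rightarrow> (complex ^ 'n \<Rightarrow> complex ^ 'n) \<Rightarrow> bool" where
  "biholomorphic_automorphism U k \<longleftrightarrow>
     bij_betw k U U \<and> holomorphic_map k U \<and> holomorphic_map (inv_into U k) U"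

definition complex_jacobian :: "(complex ^ 'n \<Rightarrow> complex ^ 'm) \<Rightarrow> complex ^ 'n \<Rightarrow> complex ^ 'n ^ 'm" where
  "complex_jacobian F z = (\<chi> i j. deriv (\<lambda>t. F (z + axis j t) $ i) 0)"

subsection \<open>The domains and their Shilov boundaries\<close>

definition tetrablock :: "(complex ^ 3) set" where
  "tetrablock = {x. \<forall>z\<in>cball 0 1. \<forall>w\<in>cball 0 1. 1 - x $ 1 * z - x $ 2 * w + x $ 3 * z * w \<noteq> 0}"

definition shilov_tetrablock :: "(complex ^ 3) set" where
  "shilov_tetrablock = {x. x $ 1 = cnj (x $ 2) * x $ 3 \<and> norm (x $ 3) = 1 \<and> norm (x $ 2) \<le> 1}"

definition sym_matrix :: "complex ^ 3 \<Rightarrow> complex ^ 2 ^ 2" where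
  "sym_matrix z = vector [vector [z $ 1, z $ 3], vector [z $ 3, z $ 2]]"

definition adjoint_matrix :: "complex ^ 'n ^ 'm \<Rightarrow> complex ^ 'm ^ 'n" where
  "adjoint_matrix A = (\<chi> i j. cnj (A $ j $ i))"

definition unitary_matrix :: "complex ^ 'n ^ 'n \<Rightarrow> bool" where
  "unitary_matrix A \<longleftrightarrow> A ** adjoint_matrix A = mat 1 \<and> adjoint_matrix A ** A = mat 1"

definition cartan_II :: "(complex ^ 3) set" where
  "cartan_II = {z. onorm (\<lambda>v. sym_matrix z *v v) < 1}"

definition shilov_cartan_II :: "(complex ^ 3) set" where
  "shilov_cartan_II = {z. unitary_matrix (sym_matrix z)}"

definition cartan_II_linear_automorphisms :: "(complex ^ 3 \<Rightarrow> complex ^ 3) set" where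
  "cartan_II_linear_automorphisms =
     {k. Vector_Spaces.linear (*s) (*s) k \<and> biholomorphic_automorphism cartan_II k}"

subsection \<open>The measures on the Shilov boundaries\<close>

text \<open>
  The measures have the Shilov boundaries themselves as underlying spaces. Linear automorphisms of
  the Cartan domain map its Shilov boundary to itself, so the image measure below is meaningful.
  The invariant probability measure is unique; it enters the development as a parameter \<open>\<Theta>\<close>
  characterised by this predicate.
\<close>

definition invariant_probability :: "(complex ^ 3) measure \<Rightarrow> bool" where
  "invariant_probability \<Theta> \<longleftrightarrow>
     prob_space \<Theta> \<and>
     sets \<Theta> = sets (restrict_space borel shilov_cartan_II) \<and>
     (\<forall>k\<in>cartan_II_linear_automorphisms. distr \<Theta> (restrict_space borel shilov_cartan_II) k = \<Theta>)"

definition tetra_map :: "complex ^ 3 \<Rightarrow> complex ^ 3" where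
  "tetra_map z = vector [z $ 1, z $ 2, z $ 1 * z $ 2 - (z $ 3)\<^sup>2]"

definition tetra_jac :: "complex ^ 3 \<Rightarrow> complex" where
  "tetra_jac z = det (complex_jacobian tetra_map z)"

definition tetra_const :: "(complex ^ 3) measure \<Rightarrow> real" where
  "tetra_const \<Theta> = (\<integral>z. (norm (tetra_jac z))\<^sup>2 \<partial>\<Theta>)"

definition tetra_measure :: "(complex ^ 3) measure \<Rightarrow> (complex ^ 3) measure" where
  "tetra_measure \<Theta> =
     distr (density \<Theta> (\<lambda>z. ennreal ((norm (tetra_jac z))\<^sup>2 / tetra_const \<Theta>)))
       (restrict_space borel shilov_tetrablock) tetra_map"

subsection \<open>Lebesgue spaces\<close>

text \<open>
  Elements of the Lebesgue spaces are represented by functions; equality in these spaces is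
  equality almost everywhere.
\<close>

definition L2_space :: "'a measure \<Rightarrow> ('a \<Rightarrow> complex) set" where
  "L2_space M = {f \<in> borel_measurable M. integrable M (\<lambda>x. (norm (f x))\<^sup>2)}"

definition L2_inner :: "'a measure \<Rightarrow> ('a \<Rightarrow> complex) \<Rightarrow> ('a \<Rightarrow> complex) \<Rightarrow> complex" where
  "L2_inner M f g = (\<integral>x. f x * cnj (g x) \<partial>M)"

definition L2_norm :: "'a measure \<Rightarrow> ('a \<Rightarrow> complex) \<Rightarrow> real" where
  "L2_norm M f = sqrt (\<integral>x. (norm (f x))\<^sup>2 \<partial>M)"

definition Linf_space :: "'a measure \<Rightarrow> ('a \<Rightarrow> complex) set" where
  "Linf_space M = {f \<in> borel_measurable M. \<exists>B. AE x in M. norm (f x) \<le> B}"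

definition orthogonal_projection ::
    "'a measure \<Rightarrow> ('a \<Rightarrow> complex) set \<Rightarrow> (('a \<Rightarrow> complex) \<Rightarrow> ('a \<Rightarrow> complex)) \<Rightarrow> bool" where
  "orthogonal_projection M H P \<longleftrightarrow>
     (\<forall>f\<in>L2_space M. P f \<in> H \<and> (\<forall>h\<in>H. L2_inner M (\<lambda>x. f x - P f x) h = 0))"

text \<open>Compactness of an operator on a closed subspace \<open>H\<close> of \<open>L\<^sup>2(M)\<close>.\<close>

definition compact_operator ::
    "'a measure \<Rightarrow> ('a \<Rightarrow> complex) set \<Rightarrow> (('a \<Rightarrow> complex) \<Rightarrow> ('a \<Rightarrow> complex)) \<Rightarrow> bool" where
  "compact_operator M H T \<longleftrightarrow>
     (\<forall>f :: nat \<Rightarrow> 'a \<Rightarrow> complex. (\<forall>n. f n \<in> H) \<and> (\<exists>B. \<forall>n. L2_norm M (f n) \<le> B) \<longrightarrow>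
        (\<exists>g\<in>H. \<exists>s. strict_mono s \<and> (\<lambda>n. L2_norm M (\<lambda>x. T (f (s n)) x - g x)) \<longlonglongrightarrow> 0))"

subsection \<open>Hardy spaces and Toeplitz operators\<close>

definition hardy_norm :: "(complex ^ 3) measure \<Rightarrow> (complex ^ 3 \<Rightarrow> complex) \<Rightarrow> ereal" where
  "hardy_norm \<Theta> F = (SUP r\<in>{0<..<1}. ereal (L2_norm \<Theta> (\<lambda>z. F (r *\<^sub>R z))))"

definition radial_limit ::
    "(complex ^ 3) measure \<Rightarrow> (complex ^ 3 \<Rightarrow> complex) \<Rightarrow> (complex ^ 3 \<Rightarrow> complex) \<Rightarrow> bool" where
  "radial_limit \<Theta> F G \<longleftrightarrow> (AE z in \<Theta>. ((\<lambda>r. F (r *\<^sub>R z)) \<longlongrightarrow> G z) (at_left 1))"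

definition hardy_tetrablock :: "(complex ^ 3) measure \<Rightarrow> (complex ^ 3 \<Rightarrow> complex) set" where
  "hardy_tetrablock \<Theta> =
     {f. holomorphic_several f tetrablock \<and>
         hardy_norm \<Theta> (\<lambda>z. tetra_jac z * f (tetra_map z)) < \<infinity>}"

text \<open>
  The Hardy space as a subspace of \<open>L\<^sup>2\<close> of the Shilov boundary: all (representatives of)
  boundary values of its elements.
\<close>

definition hardy_boundary :: "(complex ^ 3) measure \<Rightarrow> (complex ^ 3 \<Rightarrow> complex) set" where
  "hardy_boundary \<Theta> =
     {g \<in> L2_space (tetra_measure \<Theta>). \<exists>f\<in>hardy_tetrablock \<Theta>.
        radial_limit \<Theta> (\<lambda>z. tetra_jac z * f (tetra_map z)) (\<lambda>z. tetra_jac z * g (tetra_map z))}"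

text \<open>Here \<open>P\<close> is the orthogonal projection of \<open>L\<^sup>2\<close> onto the Hardy space.\<close>

definition toeplitz ::
    "(('a \<Rightarrow> complex) \<Rightarrow> ('a \<Rightarrow> complex)) \<Rightarrow> ('a \<Rightarrow> complex) \<Rightarrow> ('a \<Rightarrow> complex) \<Rightarrow> ('a \<Rightarrow> complex)"
  where "toeplitz P u f = P (\<lambda>x. u x * f x)"

end

theory Submission
  imports Defs
begin

text \<open>
  The argument is the one of Brown and Halmos. Let \<open>T\<close> be the Toeplitz operator with symbol \<open>u\<close>, and
  let \<open>w\<close> be the third coordinate, restricted to the Shilov boundary of the tetrablock. It is unimodular there, and multiplication by \<open>w\<close> maps the Hardy
  space into itself. Hence \<open>\<langle>T (w\<^sup>n f), w\<^sup>n g\<rangle> = \<langle>u w\<^sup>n f, w\<^sup>n g\<rangle> = \<langle>u f, g\<rangle>\<close> for all \<open>n\<close> and all \<open>f\<close>, \<open>g\<close>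
  in the Hardy space. If \<open>T\<close> is compact, then along a subsequence \<open>T (w\<^sup>n f)\<close> tends in norm to some
  \<open>G\<close>, so that \<open>\<langle>u f, g\<rangle>\<close> is a limit of the numbers \<open>\<langle>G, w\<^sup>n g\<rangle>\<close>. These tend to \<open>0\<close>, because they are
  Fourier coefficients, with respect to \<open>w\<close>, of the integrable function \<open>G g\<^sup>*\<close>. So \<open>\<langle>u f, g\<rangle> = 0\<close> for
  every \<open>g\<close>, and \<open>g = T f\<close> gives \<open>\<parallel>T f\<parallel>\<^sup>2 = \<langle>u f, T f\<rangle> = 0\<close>. This much holds on any finite measure
  space (\<open>compact_toeplitz_eq_0\<close>).

  Two properties of the tetrablock enter. That the moments \<open>\<integral>w\<^sup>n\<close> vanish for \<open>n \<ge> 1\<close>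
  (\<open>tetra_measure_moments\<close>) is what makes the powers of \<open>w\<close> orthogonal, hence the Fourier coefficients
  null; it follows from the invariance of \<open>\<Theta>\<close> under scalar rotations. That \<open>w\<close> multiplies the Hardy
  space into itself (\<open>hardy_boundary_mult_nth3\<close>) holds because \<open>w\<close> pulls back to the determinant on
  the Cartan domain, which is homogeneous and has modulus \<open>1\<close> at unitary matrices.
\<close>

section \<open>Square-integrable functions\<close>

lemma borel_measurable_cnj [measurable (raw)]:
  assumes "f \<in> borel_measurable M"
  shows "(\<lambda>x. cnj (f x)) \<in> borel_measurable M"
proof -
  have "cnj \<in> borel_measurable borel"
    by (intro borel_measurable_continuous_onI continuous_on_cnj continuous_on_id)
  from measurable_compose[OF assms this] show ?thesis .
qed

lemma L2_mult_cnj_integrable: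
  assumes "f \<in> L2_space M" "g \<in> L2_space M"
  shows "integrable M (\<lambda>x. f x * cnj (g x))"
proof (rule Bochner_Integration.integrable_bound)
  show "integrable M (\<lambda>x. (norm (f x))\<^sup>2 + (norm (g x))\<^sup>2)"
    using assms by (auto simp: L2_space_def)
  show "(\<lambda>x. f x * cnj (g x)) \<in> borel_measurable M"
    using assms by (auto simp: L2_space_def)
  have "a * b \<le> a\<^sup>2 + b\<^sup>2" if "a \<ge> 0" "b \<ge> 0" for a b :: real
    using sum_squares_bound[of a b] that mult_nonneg_nonneg[OF that] by linarith
  then show "AE x in M. norm (f x * cnj (g x)) \<le> norm ((norm (f x))\<^sup>2 + (norm (g x))\<^sup>2)"
    by (auto simp: norm_mult)
qed

lemma L2_diff:
  assumes "f \<in> L2_space M" "g \<in> L2_space M"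
  shows "(\<lambda>x. f x - g x) \<in> L2_space M"
proof -
  have m: "f \<in> borel_measurable M" "g \<in> borel_measurable M"
    using assms by (auto simp: L2_space_def)
  have "integrable M (\<lambda>x. (norm (f x - g x))\<^sup>2)"
  proof (rule Bochner_Integration.integrable_bound)
    show "integrable M (\<lambda>x. 2 * (norm (f x))\<^sup>2 + 2 * (norm (g x))\<^sup>2)"
      using assms by (auto simp: L2_space_def)
    show "(\<lambda>x. (norm (f x - g x))\<^sup>2) \<in> borel_measurable M"
      using m by measurable
    have "(norm (a - b))\<^sup>2 \<le> 2 * (norm a)\<^sup>2 + 2 * (norm b)\<^sup>2" for a b :: complex
    proof -
      have "(norm (a - b))\<^sup>2 \<le> (norm a + norm b)\<^sup>2"
        by (intro power_mono norm_triangle_ineq4) auto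
      also have "\<dots> \<le> 2 * (norm a)\<^sup>2 + 2 * (norm b)\<^sup>2"
        using sum_squares_bound[of "norm a" "norm b"] by (simp add: power2_sum)
      finally show ?thesis .
    qed
    then show "AE x in M. norm ((norm (f x - g x))\<^sup>2)
        \<le> norm (2 * (norm (f x))\<^sup>2 + 2 * (norm (g x))\<^sup>2)"
      by (auto simp: abs_of_nonneg)
  qed
  with m show ?thesis by (auto simp: L2_space_def)
qed

lemma L2_bounded_mult:
  assumes f: "f \<in> L2_space M" and u: "u \<in> borel_measurable M"
    and B: "AE x in M. norm (u x) \<le> B"
  shows "(\<lambda>x. u x * f x) \<in> L2_space M"
proof -
  have m: "f \<in> borel_measurable M" using f by (auto simp: L2_space_def)
  have "integrable M (\<lambda>x. (norm (u x * f x))\<^sup>2)"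
  proof (rule Bochner_Integration.integrable_bound)
    show "integrable M (\<lambda>x. B\<^sup>2 * (norm (f x))\<^sup>2)"
      using f by (auto simp: L2_space_def)
    show "(\<lambda>x. (norm (u x * f x))\<^sup>2) \<in> borel_measurable M"
      using m u by measurable
    show "AE x in M. norm ((norm (u x * f x))\<^sup>2) \<le> norm (B\<^sup>2 * (norm (f x))\<^sup>2)"
      using B by eventually_elim
        (auto simp: norm_mult power_mult_distrib intro!: mult_right_mono power_mono)
  qed
  with m u show ?thesis by (auto simp: L2_space_def)
qed

lemma bounded_measurable_L2:
  assumes "finite_measure M" "f \<in> borel_measurable M" "\<And>x. x \<in> space M \<Longrightarrow> norm (f x) \<le> B"
  shows "f \<in> L2_space M"
proof -
  interpret finite_measure M by fact
  have "(\<lambda>x. 1) \<in> L2_space M" by (simp add: L2_space_def)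
  from L2_bounded_mult[OF this assms(2), of B] assms(3) show ?thesis by auto
qed

lemma L2_inner_self: "L2_inner M f f = of_real (\<integral>x. (norm (f x))\<^sup>2 \<partial>M)"
  by (simp only: L2_inner_def complex_norm_square[symmetric] integral_complex_of_real)

lemma integral_complex_cnj: "(\<integral>x. cnj (f x) \<partial>M) = cnj (\<integral>x. f x \<partial>M)"
  by (rule integral_bounded_linear'[OF bounded_linear_cnj bounded_linear_cnj]) simp

lemma L2_inner_commute: "L2_inner M f g = cnj (L2_inner M g f)"
  by (simp add: L2_inner_def mult.commute flip: integral_complex_cnj)

lemma L2_Cauchy_Schwarz:
  assumes f: "f \<in> L2_space M" and g: "g \<in> L2_space M"
  shows "norm (L2_inner M f g) \<le> L2_norm M f * L2_norm M g"
proof -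
  let ?F = "\<lambda>x. norm (f x)" and ?G = "\<lambda>x. norm (g x)"
  have m[measurable]: "f \<in> borel_measurable M" "g \<in> borel_measurable M"
    and i: "integrable M (\<lambda>x. (?F x)\<^sup>2)" "integrable M (\<lambda>x. (?G x)\<^sup>2)"
    using f g by (auto simp: L2_space_def)
  have ifg: "integrable M (\<lambda>x. ?F x * ?G x)"
    using integrable_norm[OF L2_mult_cnj_integrable[OF f g]] by (simp add: norm_mult)
  have "(\<integral>\<^sup>+x. ennreal (?F x) * ennreal (?G x) \<partial>M)\<^sup>2
      \<le> (\<integral>\<^sup>+x. (ennreal (?F x))\<^sup>2 \<partial>M) * (\<integral>\<^sup>+x. (ennreal (?G x))\<^sup>2 \<partial>M)"
    by (rule Cauchy_Schwarz_nn_integral) auto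
  also have "(\<integral>\<^sup>+x. ennreal (?F x) * ennreal (?G x) \<partial>M) = ennreal (\<integral>x. ?F x * ?G x \<partial>M)"
    by (subst nn_integral_eq_integral[OF ifg, symmetric]) (auto simp: ennreal_mult)
  also have "(\<integral>\<^sup>+x. (ennreal (?F x))\<^sup>2 \<partial>M) = ennreal (\<integral>x. (?F x)\<^sup>2 \<partial>M)"
    by (subst nn_integral_eq_integral[OF i(1), symmetric]) (auto simp: ennreal_power)
  also have "(\<integral>\<^sup>+x. (ennreal (?G x))\<^sup>2 \<partial>M) = ennreal (\<integral>x. (?G x)\<^sup>2 \<partial>M)"
    by (subst nn_integral_eq_integral[OF i(2), symmetric]) (auto simp: ennreal_power)
  finally have le: "(\<integral>x. ?F x * ?G x \<partial>M)\<^sup>2 \<le> (\<integral>x. (?F x)\<^sup>2 \<partial>M) * (\<integral>x. (?G x)\<^sup>2 \<partial>M)"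
    by (simp add: ennreal_power flip: ennreal_mult)
  have "norm (L2_inner M f g) \<le> (\<integral>x. ?F x * ?G x \<partial>M)"
    unfolding L2_inner_def using integral_norm_bound[of M "\<lambda>x. f x * cnj (g x)"]
    by (simp add: norm_mult)
  also have "\<dots> \<le> L2_norm M f * L2_norm M g"
    unfolding L2_norm_def real_sqrt_mult[symmetric] by (rule real_le_rsqrt[OF le])
  finally show ?thesis .
qed

section \<open>Powers of a unimodular function with vanishing moments\<close>

text \<open>
  The powers are pairwise orthogonal, all with squared norm the total mass, so Bessel's inequality
  makes the coefficients of \<open>F\<close> square summable.
\<close>

lemma Bessel_unimodular_powers:
  fixes w :: "'a \<Rightarrow> complex"
  assumes fin: "finite_measure M" and w: "w \<in> borel_measurable M"
    and uni: "\<And>x. x \<in> space M \<Longrightarrow> norm (w x) = 1"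
    and mom: "\<And>n. n \<ge> 1 \<Longrightarrow> (\<integral>x. w x ^ n \<partial>M) = 0"
    and F: "F \<in> L2_space M"
  shows "(\<lambda>n. L2_inner M F (\<lambda>x. w x ^ n)) \<longlonglongrightarrow> 0"
proof -
  interpret finite_measure M by fact
  define c where "c = (\<lambda>n. L2_inner M F (\<lambda>x. w x ^ n))"
  define m where "m = measure M (space M)"
  \<comment> \<open>The estimate below works for any \<open>t > 0\<close> with \<open>t * m \<le> 1\<close>; the summand \<open>1\<close> covers \<open>m = 0\<close>.\<close>
  define t where "t = 1 / (m + 1)"
  have m0: "m \<ge> 0" by (simp add: m_def)
  have t0: "t > 0" and tm: "t * m \<le> 1" using m0 by (auto simp: t_def field_simps)
  have pL2: "(\<lambda>x. w x ^ n) \<in> L2_space M" for n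
    by (rule bounded_measurable_L2[OF fin, where B = 1]) (use w uni in \<open>auto simp: norm_power\<close>)
  have orth: "L2_inner M (\<lambda>x. w x ^ k) (\<lambda>x. w x ^ l) = (if k = l then of_real m else 0)" for k l
  proof -
    have cc: "w x * cnj (w x) = 1" if "x \<in> space M" for x
      using uni[OF that] by (simp flip: complex_norm_square)
    consider "k = l" | "l < k" | "k < l" by linarith
    then show ?thesis
    proof cases
      case 1
      have "L2_inner M (\<lambda>x. w x ^ k) (\<lambda>x. w x ^ l) = (\<integral>x. 1 \<partial>M)"
        unfolding L2_inner_def using 1 cc
        by (intro Bochner_Integration.integral_cong) (auto simp flip: power_mult_distrib)
      then show ?thesis using 1 by (simp add: m_def scaleR_conv_of_real)
    next
      case 2
      then have d: "k = l + (k - l)" "k - l \<ge> 1" by auto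
      have "L2_inner M (\<lambda>x. w x ^ k) (\<lambda>x. w x ^ l) = (\<integral>x. w x ^ (k - l) \<partial>M)"
        unfolding L2_inner_def
      proof (intro Bochner_Integration.integral_cong refl)
        fix x assume "x \<in> space M"
        then have "(w x * cnj (w x)) ^ l = 1" by (simp add: cc)
        then show "w x ^ k * cnj (w x ^ l) = w x ^ (k - l)"
          by (subst d(1)) (simp add: power_add power_mult_distrib mult.assoc mult.left_commute)
      qed
      then show ?thesis using mom[OF d(2)] 2 by simp
    next
      case 3
      then have d: "l = k + (l - k)" "l - k \<ge> 1" by auto
      have "L2_inner M (\<lambda>x. w x ^ k) (\<lambda>x. w x ^ l) = (\<integral>x. cnj (w x ^ (l - k)) \<partial>M)"
        unfolding L2_inner_def
      proof (intro Bochner_Integration.integral_cong refl)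
        fix x assume "x \<in> space M"
        then have "(w x * cnj (w x)) ^ k = 1" by (simp add: cc)
        then show "w x ^ k * cnj (w x ^ l) = cnj (w x ^ (l - k))"
          by (subst d(1)) (simp add: power_add power_mult_distrib flip: mult.assoc)
      qed
      also have "\<dots> = cnj (\<integral>x. w x ^ (l - k) \<partial>M)" by (rule integral_complex_cnj)
      finally show ?thesis using mom[OF d(2)] 3 by simp
    qed
  qed
  have bound: "(\<Sum>k<N. (norm (c k))\<^sup>2) \<le> (\<integral>x. (norm (F x))\<^sup>2 \<partial>M) / t" for N
  proof -
    define A where "A = (\<Sum>k<N. (norm (c k))\<^sup>2)"
    \<comment> \<open>The damped partial sum: \<open>t\<close> replaces the reciprocal of the mass in the Fourier expansion.\<close>
    define S where "S = (\<lambda>x. \<Sum>k<N. of_real t * c k * w x ^ k)"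
    have A0: "A \<ge> 0" by (simp add: A_def sum_nonneg)
    have SL2: "S \<in> L2_space M"
    proof (rule bounded_measurable_L2[OF fin, where B = "\<Sum>k<N. norm (of_real t * c k)"])
      show "S \<in> borel_measurable M" unfolding S_def using w by measurable
      show "norm (S x) \<le> (\<Sum>k<N. norm (of_real t * c k))" if "x \<in> space M" for x
        unfolding S_def by (rule sum_norm_le) (simp add: norm_mult norm_power uni[OF that])
    qed
    have in_S: "L2_inner M G S = (\<Sum>k<N. of_real t * cnj (c k) * L2_inner M G (\<lambda>x. w x ^ k))"
      if G: "G \<in> L2_space M" for G
    proof -
      have "L2_inner M G S
          = (\<integral>x. (\<Sum>k<N. of_real t * cnj (c k) * (G x * cnj (w x ^ k))) \<partial>M)"
        unfolding L2_inner_def S_def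
        by (intro Bochner_Integration.integral_cong refl)
          (simp add: sum_distrib_left algebra_simps)
      also have "\<dots> = (\<Sum>k<N. of_real t * cnj (c k) * L2_inner M G (\<lambda>x. w x ^ k))"
        unfolding L2_inner_def
        by (subst Bochner_Integration.integral_sum)
          (auto intro!: integrable_mult_right L2_mult_cnj_integrable[OF G pL2, simplified])
      finally show ?thesis .
    qed
    have sq: "cnj (c k) * c k = of_real ((norm (c k))\<^sup>2)" for k
      by (simp only: complex_norm_square mult.commute)
    have c_eq: "L2_inner M F (\<lambda>x. w x ^ k) = c k" for k by (simp add: c_def)
    have FS: "L2_inner M F S = of_real (t * A)"
      unfolding in_S[OF F] A_def c_eq mult.assoc sq by (simp add: sum_distrib_left)
    have pS: "L2_inner M S (\<lambda>x. w x ^ k) = of_real t * c k * of_real m" if "k < N" for k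
    proof -
      have "L2_inner M (\<lambda>x. w x ^ k) S = of_real t * cnj (c k) * of_real m"
        unfolding in_S[OF pL2] orth using that by (simp add: if_distrib cong: if_cong)
      then show ?thesis by (subst L2_inner_commute) simp
    qed
    have SS: "L2_inner M S S = of_real (t * (t * m) * A)"
    proof -
      have "L2_inner M S S
          = (\<Sum>k<N. of_real t * cnj (c k) * (of_real t * c k * of_real m))"
        unfolding in_S[OF SL2] by (intro sum.cong refl) (simp add: pS)
      also have "\<dots> = (\<Sum>k<N. of_real (t * (t * m)) * (cnj (c k) * c k))"
        by (intro sum.cong refl) (simp add: algebra_simps)
      finally show ?thesis
        unfolding A_def sq by (simp add: sum_distrib_left)
    qed
    have ii: "integrable M (\<lambda>x. F x * cnj (F x))" "integrable M (\<lambda>x. F x * cnj (S x))"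
      "integrable M (\<lambda>x. S x * cnj (F x))" "integrable M (\<lambda>x. S x * cnj (S x))"
      using F SL2 by (auto intro: L2_mult_cnj_integrable)
    have "L2_inner M (\<lambda>x. F x - S x) (\<lambda>x. F x - S x)
        = (\<integral>x. F x * cnj (F x) - F x * cnj (S x) - (S x * cnj (F x) - S x * cnj (S x)) \<partial>M)"
      unfolding L2_inner_def
      by (intro Bochner_Integration.integral_cong) (auto simp: algebra_simps)
    also have "\<dots> = L2_inner M F F - L2_inner M F S - (L2_inner M S F - L2_inner M S S)"
      unfolding L2_inner_def using ii by simp
    also have "L2_inner M S F = of_real (t * A)" by (subst L2_inner_commute) (simp add: FS)
    finally have "of_real (\<integral>x. (norm (F x - S x))\<^sup>2 \<partial>M)
        = (of_real ((\<integral>x. (norm (F x))\<^sup>2 \<partial>M) - 2 * (t * A) + t * (t * m) * A) :: complex)"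
      unfolding FS SS unfolding L2_inner_self by simp
    then have "(\<integral>x. (norm (F x - S x))\<^sup>2 \<partial>M)
        = (\<integral>x. (norm (F x))\<^sup>2 \<partial>M) - 2 * (t * A) + t * (t * m) * A"
      unfolding of_real_eq_iff .
    moreover have "(\<integral>x. (norm (F x - S x))\<^sup>2 \<partial>M) \<ge> 0" by simp
    moreover have "t * (t * m) * A \<le> t * A"
      using mult_right_mono[OF tm, of "t * A"] t0 A0 by (simp add: algebra_simps)
    ultimately have "t * A \<le> (\<integral>x. (norm (F x))\<^sup>2 \<partial>M)" by linarith
    then show ?thesis using t0 by (simp add: A_def field_simps)
  qed
  have "summable (\<lambda>k. (norm (c k))\<^sup>2)"
    by (rule summableI_nonneg_bounded[OF _ bound]) simp
  then have "(\<lambda>k. (norm (c k))\<^sup>2) \<longlonglongrightarrow> 0" by (rule summable_LIMSEQ_zero)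
  then have "(\<lambda>k. sqrt ((norm (c k))\<^sup>2)) \<longlonglongrightarrow> sqrt 0" by (rule tendsto_real_sqrt)
  then show ?thesis by (simp add: c_def tendsto_norm_zero_iff)
qed

text \<open>
  Coefficients depend continuously on \<open>F\<close> in the \<open>L\<^sup>1\<close> norm, uniformly in \<open>n\<close>, and the truncations of
  \<open>F\<close>, which converge to it in that norm, are square integrable.
\<close>

lemma Riemann_Lebesgue_unimodular_powers:
  fixes w :: "'a \<Rightarrow> complex"
  assumes fin: "finite_measure M" and w: "w \<in> borel_measurable M"
    and uni: "\<And>x. x \<in> space M \<Longrightarrow> norm (w x) = 1"
    and mom: "\<And>n. n \<ge> 1 \<Longrightarrow> (\<integral>x. w x ^ n \<partial>M) = 0"
    and F: "integrable M F"
  shows "(\<lambda>n. L2_inner M F (\<lambda>x. w x ^ n)) \<longlonglongrightarrow> 0"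
proof -
  define G where "G = (\<lambda>(k::nat) x. if norm (F x) \<le> real k then F x else 0)"
  have mF[measurable]: "F \<in> borel_measurable M" using F by auto
  have mG[measurable]: "G k \<in> borel_measurable M" for k unfolding G_def by measurable
  have GL2: "G k \<in> L2_space M" for k
    by (rule bounded_measurable_L2[OF fin mG, where B = "real k"]) (auto simp: G_def)
  have iG: "integrable M (G k)" for k
    by (rule Bochner_Integration.integrable_bound[OF F mG]) (auto simp: G_def)
  have "(\<lambda>k. \<integral>x. norm (F x - G k x) \<partial>M) \<longlonglongrightarrow> (\<integral>x. 0 \<partial>M)"
  proof (rule integral_dominated_convergence[where w = "\<lambda>x. norm (F x)"])
    show "AE x in M. (\<lambda>k. norm (F x - G k x)) \<longlonglongrightarrow> 0"
    proof (rule AE_I2)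
      fix x
      have "eventually (\<lambda>k. norm (F x - G k x) = 0) sequentially"
        using eventually_ge_at_top[of "nat \<lceil>norm (F x)\<rceil>"]
        by eventually_elim (auto simp: G_def nat_le_iff ceiling_le_iff)
      then show "(\<lambda>k. norm (F x - G k x)) \<longlonglongrightarrow> 0" by (rule tendsto_eventually)
    qed
  qed (use F in \<open>auto simp: G_def\<close>)
  then have appr: "(\<lambda>k. \<integral>x. norm (F x - G k x) \<partial>M) \<longlonglongrightarrow> 0" by simp
  show ?thesis
  proof (rule LIMSEQ_I)
    fix e :: real assume e: "e > 0"
    from LIMSEQ_D[OF appr, of "e / 2"] e obtain k where
      k: "(\<integral>x. norm (F x - G k x) \<partial>M) < e / 2" by force
    have "(\<lambda>n. L2_inner M (G k) (\<lambda>x. w x ^ n)) \<longlonglongrightarrow> 0"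
      by (rule Bessel_unimodular_powers[OF fin w uni mom GL2])
    from LIMSEQ_D[OF this, of "e / 2"] e obtain N where
      N: "\<And>n. n \<ge> N \<Longrightarrow> norm (L2_inner M (G k) (\<lambda>x. w x ^ n)) < e / 2" by auto
    have "norm (L2_inner M F (\<lambda>x. w x ^ n)) < e" if n: "n \<ge> N" for n
    proof -
      have im: "integrable M (\<lambda>x. f x * cnj (w x ^ n))" if "integrable M f" for f
      proof (rule Bochner_Integration.integrable_bound[OF that])
        have "f \<in> borel_measurable M" using that by auto
        then show "(\<lambda>x. f x * cnj (w x ^ n)) \<in> borel_measurable M" using w by measurable
      qed (auto simp: norm_mult norm_power uni)
      have "L2_inner M F (\<lambda>x. w x ^ n) = L2_inner M (G k) (\<lambda>x. w x ^ n)
          + L2_inner M (\<lambda>x. F x - G k x) (\<lambda>x. w x ^ n)"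
        using im[OF F] im[OF iG[of k]] im[OF Bochner_Integration.integrable_diff[OF F iG[of k]]]
        unfolding L2_inner_def by (simp add: left_diff_distrib)
      moreover have "norm (L2_inner M (\<lambda>x. F x - G k x) (\<lambda>x. w x ^ n))
          \<le> (\<integral>x. norm (F x - G k x) \<partial>M)"
      proof -
        have "norm (L2_inner M (\<lambda>x. F x - G k x) (\<lambda>x. w x ^ n))
            \<le> (\<integral>x. norm ((F x - G k x) * cnj (w x ^ n)) \<partial>M)"
          unfolding L2_inner_def by (rule integral_norm_bound)
        also have "\<dots> = (\<integral>x. norm (F x - G k x) \<partial>M)"
          by (intro Bochner_Integration.integral_cong) (auto simp: norm_mult norm_power uni)
        finally show ?thesis .
      qed
      ultimately show ?thesis
        using k N[OF n] norm_triangle_ineq[of "L2_inner M (G k) (\<lambda>x. w x ^ n)"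
            "L2_inner M (\<lambda>x. F x - G k x) (\<lambda>x. w x ^ n)"] by simp
    qed
    then show "\<exists>N. \<forall>n\<ge>N. norm (L2_inner M F (\<lambda>x. w x ^ n) - 0) < e" by auto
  qed
qed

section \<open>Compact Toeplitz operators on a shift-invariant subspace\<close>

text \<open>
  Shifting both arguments of the sesquilinear form \<open>\<langle>u f, g\<rangle>\<close> by \<open>w\<^sup>n\<close> does not change it, while compactness
  and the vanishing of Fourier coefficients at infinity force the shifted values to tend to \<open>0\<close>.
\<close>

lemma compact_toeplitz_eq_0:
  fixes w :: "'a \<Rightarrow> complex"
  assumes fin: "finite_measure M" and w: "w \<in> borel_measurable M"
    and uni: "\<And>x. x \<in> space M \<Longrightarrow> norm (w x) = 1"
    and mom: "\<And>n. n \<ge> 1 \<Longrightarrow> (\<integral>x. w x ^ n \<partial>M) = 0"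
    and H: "H \<subseteq> L2_space M" and shift: "\<And>h. h \<in> H \<Longrightarrow> (\<lambda>x. w x * h x) \<in> H"
    and P: "orthogonal_projection M H P" and u: "u \<in> Linf_space M"
    and comp: "compact_operator M H (toeplitz P u)"
    and f: "f \<in> H"
  shows "AE x in M. toeplitz P u f x = 0"
proof -
  have shifts: "(\<lambda>x. w x ^ n * h x) \<in> H" if "h \<in> H" for h n
  proof (induction n)
    case (Suc n)
    from shift[OF Suc] show ?case by (simp add: mult.assoc)
  qed (use that in simp)
  obtain B where um: "u \<in> borel_measurable M" and uB: "AE x in M. norm (u x) \<le> B"
    using u by (auto simp: Linf_space_def)
  have uL2: "(\<lambda>x. u x * h x) \<in> L2_space M" if "h \<in> H" for h
    using L2_bounded_mult[OF _ um uB] that H by auto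
  have TH: "toeplitz P u h \<in> H" if "h \<in> H" for h
    using P uL2[OF that] by (auto simp: orthogonal_projection_def toeplitz_def)
  have T_inner: "L2_inner M (toeplitz P u h) k = L2_inner M (\<lambda>x. u x * h x) k"
    if "h \<in> H" "k \<in> H" for h k
  proof -
    have "L2_inner M (\<lambda>x. u x * h x - toeplitz P u h x) k = 0"
      using P uL2[OF that(1)] that(2) by (auto simp: orthogonal_projection_def toeplitz_def)
    moreover have "L2_inner M (\<lambda>x. u x * h x - toeplitz P u h x) k
        = L2_inner M (\<lambda>x. u x * h x) k - L2_inner M (toeplitz P u h) k"
      using L2_mult_cnj_integrable[OF uL2[OF that(1)], of k]
        L2_mult_cnj_integrable[of "toeplitz P u h" M k] subsetD[OF H TH[OF that(1)]]
        subsetD[OF H that(2)]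
      unfolding L2_inner_def by (simp add: left_diff_distrib)
    ultimately show ?thesis by simp
  qed
  have norm_shift: "L2_norm M (\<lambda>x. w x ^ n * h x) = L2_norm M h" for n h
    unfolding L2_norm_def
    by (intro arg_cong[of _ _ sqrt] Bochner_Integration.integral_cong)
      (auto simp: norm_mult norm_power uni)
  obtain G s where G: "G \<in> H" and s: "strict_mono s"
    and conv: "(\<lambda>n. L2_norm M (\<lambda>x. toeplitz P u (\<lambda>x. w x ^ s n * f x) x - G x)) \<longlonglongrightarrow> 0"
  proof -
    have "(\<forall>n. (\<lambda>x. w x ^ n * f x) \<in> H) \<and> (\<exists>B. \<forall>n. L2_norm M (\<lambda>x. w x ^ n * f x) \<le> B)"
      using shifts[OF f] norm_shift[of _ f] by auto
    from comp[unfolded compact_operator_def, rule_format, OF this] that show thesis by blast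
  qed
  \<comment> \<open>\<open>\<langle>T (w\<^sup>n f), w\<^sup>n g\<rangle>\<close>, along the subsequence, is both constant and a sum of two null sequences.\<close>
  have zero: "L2_inner M (\<lambda>x. u x * f x) g = 0" if g: "g \<in> H" for g
  proof -
    let ?T = "\<lambda>n. toeplitz P u (\<lambda>x. w x ^ s n * f x)" and ?g = "\<lambda>n x. w x ^ s n * g x"
    have L2: "?T n \<in> L2_space M" "?g n \<in> L2_space M" "G \<in> L2_space M" "g \<in> L2_space M" for n
      using TH shifts f g G H by auto
    have inv: "L2_inner M (?T n) (?g n) = L2_inner M (\<lambda>x. u x * f x) g" for n
    proof -
      have "L2_inner M (?T n) (?g n) = L2_inner M (\<lambda>x. u x * (w x ^ s n * f x)) (?g n)"
        by (rule T_inner) (auto intro: shifts f g)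
      also have "\<dots> = L2_inner M (\<lambda>x. u x * f x) g"
        unfolding L2_inner_def
      proof (intro Bochner_Integration.integral_cong refl)
        fix x assume "x \<in> space M"
        then have "(w x * cnj (w x)) ^ s n = 1"
          using uni by (simp flip: complex_norm_square)
        then have "w x ^ s n * cnj (w x) ^ s n = 1" by (simp add: power_mult_distrib)
        then show "u x * (w x ^ s n * f x) * cnj (w x ^ s n * g x) = u x * f x * cnj (g x)"
          by (simp add: algebra_simps)
      qed
      finally show ?thesis .
    qed
    have split: "L2_inner M (?T n) (?g n)
        = L2_inner M (\<lambda>x. ?T n x - G x) (?g n) + L2_inner M G (?g n)" for n
      using L2_mult_cnj_integrable[OF L2(1)[of n] L2(2)[of n]]
        L2_mult_cnj_integrable[OF L2(3) L2(2)[of n]]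
      unfolding L2_inner_def by (simp add: left_diff_distrib)
    have first: "(\<lambda>n. L2_inner M (\<lambda>x. ?T n x - G x) (?g n)) \<longlonglongrightarrow> 0"
    proof (rule Lim_null_comparison)
      show "\<forall>\<^sub>F n in sequentially. norm (L2_inner M (\<lambda>x. ?T n x - G x) (?g n))
          \<le> L2_norm M (\<lambda>x. ?T n x - G x) * L2_norm M g"
        using L2_Cauchy_Schwarz[OF L2_diff[OF L2(1,3)] L2(2)] by (simp add: norm_shift)
      show "(\<lambda>n. L2_norm M (\<lambda>x. ?T n x - G x) * L2_norm M g) \<longlonglongrightarrow> 0"
        by (rule tendsto_mult_left_zero[OF conv])
    qed
    have "(\<lambda>n. L2_inner M (\<lambda>x. G x * cnj (g x)) (\<lambda>x. w x ^ n)) \<longlonglongrightarrow> 0"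
      by (rule Riemann_Lebesgue_unimodular_powers[OF fin w uni mom
            L2_mult_cnj_integrable[OF L2(3,4)]])
    from LIMSEQ_subseq_LIMSEQ[OF this s]
    have "(\<lambda>n. L2_inner M G (?g n)) \<longlonglongrightarrow> 0"
      by (simp add: o_def L2_inner_def algebra_simps)
    from tendsto_add[OF first this] have "(\<lambda>n. L2_inner M (?T n) (?g n)) \<longlonglongrightarrow> 0"
      by (simp add: split)
    then show ?thesis by (simp add: inv LIMSEQ_const_iff)
  qed
  have TL2: "toeplitz P u f \<in> L2_space M" using TH[OF f] H by auto
  have "L2_inner M (toeplitz P u f) (toeplitz P u f) = 0"
    using T_inner[OF f TH[OF f]] zero[OF TH[OF f]] by simp
  then have "(\<integral>x. (norm (toeplitz P u f x))\<^sup>2 \<partial>M) = 0" by (simp add: L2_inner_self)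
  moreover have "integrable M (\<lambda>x. (norm (toeplitz P u f x))\<^sup>2)"
    using TL2 by (simp add: L2_space_def)
  ultimately have "AE x in M. (norm (toeplitz P u f x))\<^sup>2 = 0"
    by (subst (asm) integral_nonneg_eq_0_iff_AE) auto
  then show ?thesis by eventually_elim simp
qed

section \<open>The boundary of the Cartan domain\<close>

lemma sym_matrix_mult_nth:
  "(sym_matrix z *v v) $ 1 = z $ 1 * v $ 1 + z $ 3 * v $ 2"
  "(sym_matrix z *v v) $ 2 = z $ 3 * v $ 1 + z $ 2 * v $ 2"
  by (simp_all add: sym_matrix_def matrix_vector_mult_def sum_2)

lemma shilov_cartan_II_iff:
  "z \<in> shilov_cartan_II \<longleftrightarrow>
     z $ 1 * cnj (z $ 1) + z $ 3 * cnj (z $ 3) = 1 \<and>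
     z $ 3 * cnj (z $ 3) + z $ 2 * cnj (z $ 2) = 1 \<and>
     z $ 1 * cnj (z $ 3) + z $ 3 * cnj (z $ 2) = 0 \<and>
     z $ 3 * cnj (z $ 1) + z $ 2 * cnj (z $ 3) = 0"
  by (auto simp: shilov_cartan_II_def unitary_matrix_def adjoint_matrix_def sym_matrix_def
      matrix_matrix_mult_def mat_def vec_eq_iff forall_2 sum_2 algebra_simps)

lemma norm_le_1_if_sum_squares:
  assumes "a * cnj a + b * cnj b = 1"
  shows "norm a \<le> 1"
proof -
  have "of_real ((norm a)\<^sup>2 + (norm b)\<^sup>2) = (of_real 1 :: complex)"
    using assms by (simp only: of_real_add complex_norm_square of_real_1)
  then have "(norm a)\<^sup>2 + (norm b)\<^sup>2 = 1" unfolding of_real_eq_iff .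
  then have "(norm a)\<^sup>2 \<le> 1\<^sup>2" using zero_le_power2[of "norm b"] unfolding one_power2 by linarith
  then show ?thesis by (rule power2_le_imp_le) simp
qed

text \<open>
  For a unitary matrix the adjugate is the adjoint times the determinant \<open>d\<close>. Comparing entries gives
  the equation that defines the boundary of the tetrablock.
\<close>

lemma shilov_cartan_II_det:
  assumes "z \<in> shilov_cartan_II"
  defines "d \<equiv> z $ 1 * z $ 2 - (z $ 3)\<^sup>2"
  shows "z $ 1 = cnj (z $ 2) * d" and "norm d = 1" and "norm (z $ 2) \<le> 1" and "norm (z $ 3) \<le> 1"
proof -
  obtain a b c where abc: "z $ 1 = a" "z $ 2 = b" "z $ 3 = c" by simp
  have e: "a * cnj a + c * cnj c = 1" "c * cnj c + b * cnj b = 1"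
    "a * cnj c + c * cnj b = 0" "c * cnj a + b * cnj c = 0"
    using assms(1) unfolding shilov_cartan_II_iff abc by auto
  have d: "d = a * b - c * c" by (simp add: d_def abc power2_eq_square)
  show "z $ 1 = cnj (z $ 2) * d"
    unfolding abc d using e(2,3) by algebra
  have "d * cnj d = 1"
    unfolding d complex_cnj_diff complex_cnj_mult using e by algebra
  then have "of_real ((norm d)\<^sup>2) = (of_real 1 :: complex)"
    by (simp only: complex_norm_square of_real_1)
  then have "(norm d)\<^sup>2 = 1" unfolding of_real_eq_iff .
  then show "norm d = 1" by (simp add: power2_eq_1_iff) (smt (verit) norm_ge_zero)
  show "norm (z $ 2) \<le> 1" "norm (z $ 3) \<le> 1"
    unfolding abc using norm_le_1_if_sum_squares[of b c] norm_le_1_if_sum_squares[of c b] e(2)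
    by (auto simp: add.commute)
qed

lemma tetra_map_shilov:
  assumes "z \<in> shilov_cartan_II"
  shows "tetra_map z \<in> shilov_tetrablock"
  using shilov_cartan_II_det[OF assms] by (simp add: shilov_tetrablock_def tetra_map_def)

lemma tetra_jac_eq: "tetra_jac z = - 2 * z $ 3"
proof -
  have ax: "axis j t $ i = (if i = j then t else 0)" for i j :: 3 and t :: complex
    by (simp add: axis_def)
  have d: "deriv (\<lambda>t. a + t) 0 = 1" "deriv (\<lambda>t. (a + t) * b - c) 0 = b"
    "deriv (\<lambda>t. b * (a + t) - c) 0 = b" "deriv (\<lambda>t. c - (a + t)\<^sup>2) 0 = - 2 * a"
    for a b c :: complex
    by (rule DERIV_imp_deriv, (auto intro!: derivative_eq_intros)[1])+
  show ?thesis
    by (simp add: tetra_jac_def det_3 complex_jacobian_def tetra_map_def ax d)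
qed

section \<open>Scalar rotations as automorphisms of the Cartan domain\<close>

lemma norm_vector_smult: "norm (c *s v) = norm c * norm v" for v :: "complex ^ 'n"
  by (simp add: norm_vec_def norm_mult L2_set_right_distrib)

lemma cartan_II_rotate:
  assumes "norm c = 1"
  shows "c *s z \<in> cartan_II \<longleftrightarrow> z \<in> cartan_II"
proof -
  have "sym_matrix (c *s z) *v v = c *s (sym_matrix z *v v)" for v
    by (simp add: vec_eq_iff forall_2 sym_matrix_mult_nth algebra_simps)
  then have "onorm (\<lambda>v. sym_matrix (c *s z) *v v) = onorm (\<lambda>v. sym_matrix z *v v)"
    by (simp add: onorm_def norm_vector_smult assms)
  then show ?thesis by (simp add: cartan_II_def)
qed

text \<open>
  Openness matters because the inverse of a bijection of the domain is prescribed on the domain only;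
  its derivatives there can be computed from a formula valid on the domain once this is open.
\<close>

lemma open_cartan_II: "open cartan_II"
proof -
  let ?f = "\<lambda>z. onorm (\<lambda>v. sym_matrix z *v v)"
  have "bilinear (\<lambda>z v. sym_matrix z *v v)"
    unfolding bilinear_def
    by (auto intro!: Real_Vector_Spaces.linearI
        simp: vec_eq_iff forall_2 sym_matrix_mult_nth algebra_simps)
  from bilinear_bounded_pos[OF this] obtain B where
    B: "B > 0" "\<And>z v. norm (sym_matrix z *v v) \<le> B * norm z * norm v" by blast
  have lip: "?f z \<le> ?f w + B * dist z w" for z w
  proof -
    have "sym_matrix z *v v = sym_matrix w *v v + sym_matrix (z - w) *v v" for v
      by (simp add: vec_eq_iff forall_2 sym_matrix_mult_nth algebra_simps)
    then have "?f z \<le> ?f w + ?f (z - w)"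
      using onorm_triangle[of "(*v) (sym_matrix w)" "(*v) (sym_matrix (z - w))"] by simp
    also have "?f (z - w) \<le> B * dist z w"
      unfolding dist_norm by (rule onorm_le) (rule B(2))
    finally show ?thesis by simp
  qed
  have "B-lipschitz_on UNIV ?f"
  proof (rule lipschitz_onI)
    fix z w :: "complex ^ 3"
    show "dist (?f z) (?f w) \<le> B * dist z w"
      using lip[of z w] lip[of w z] by (simp add: dist_real_def dist_commute abs_le_iff)
  qed (use B in auto)
  then have "continuous_on UNIV ?f" by (rule lipschitz_on_continuous_on)
  then show ?thesis
    unfolding cartan_II_def by (intro open_Collect_less continuous_intros)
qed

lemma holomorphic_map_smult_on_open:
  fixes g :: "complex ^ 'n \<Rightarrow> complex ^ 'n"
  assumes "open U" "\<And>z. z \<in> U \<Longrightarrow> g z = c *s z"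
  shows "holomorphic_map g U"
  unfolding holomorphic_map_def holomorphic_several_def
proof (intro allI ballI exI conjI)
  fix i z assume z: "z \<in> U"
  have "((\<lambda>z. c * z $ i) has_derivative (\<lambda>h. c * h $ i)) (at z)"
    by (intro has_derivative_mult_right bounded_linear_imp_has_derivative bounded_linear_vec_nth)
  then show "((\<lambda>z. g z $ i) has_derivative (\<lambda>h. c * h $ i)) (at z)"
    by (rule has_derivative_transform_within_open[OF _ assms(1) z]) (simp add: assms(2))
  show "Vector_Spaces.linear (*s) (*) (\<lambda>h. c * h $ i)"
    by unfold_locales (auto simp: algebra_simps)
qed

lemma rotation_in_linear_automorphisms:
  assumes c: "norm c = 1"
  shows "(*s) c \<in> cartan_II_linear_automorphisms"
proof -
  have cc: "cnj c * c = 1" using c by (simp add: mult.commute flip: complex_norm_square)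
  have inv: "inv_into cartan_II ((*s) c) z = cnj c *s z" if "z \<in> cartan_II" for z
  proof (rule inv_into_f_eq)
    show "inj_on ((*s) c) cartan_II" using c by (auto intro!: inj_onI)
    show "cnj c *s z \<in> cartan_II" using that c cartan_II_rotate[of "cnj c"] by simp
    show "c *s (cnj c *s z) = z" using cc by (simp add: vector_smult_assoc mult.commute)
  qed
  have bij: "bij_betw ((*s) c) cartan_II cartan_II"
  proof (rule bij_betw_byWitness[where f' = "(*s) (cnj c)"])
    show "\<forall>z\<in>cartan_II. cnj c *s (c *s z) = z" "\<forall>z\<in>cartan_II. c *s (cnj c *s z) = z"
      using cc by (auto simp: vector_smult_assoc mult.commute)
    show "(*s) c ` cartan_II \<subseteq> cartan_II" "(*s) (cnj c) ` cartan_II \<subseteq> cartan_II"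
      using c cartan_II_rotate[of c] cartan_II_rotate[of "cnj c"] by auto
  qed
  have "Vector_Spaces.linear (*s) (*s) ((*s) c)"
    by unfold_locales (auto simp: vec_eq_iff algebra_simps)
  with bij show ?thesis
    unfolding cartan_II_linear_automorphisms_def biholomorphic_automorphism_def
    by (auto intro!: holomorphic_map_smult_on_open[OF open_cartan_II] simp: inv)
qed

lemma shilov_rotate:
  assumes "norm c = 1" "z \<in> shilov_cartan_II"
  shows "c *s z \<in> shilov_cartan_II"
proof -
  have cc: "c * cnj c = 1" using assms(1) by (simp flip: complex_norm_square)
  have rot: "c * x * (cnj c * y) = x * y" for x y
  proof -
    have "c * x * (cnj c * y) = (c * cnj c) * (x * y)" by (simp only: mult_ac)
    then show ?thesis by (simp only: cc mult_1)
  qed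
  show ?thesis
    using assms(2)
    unfolding shilov_cartan_II_iff vector_smult_component complex_cnj_mult rot .
qed

section \<open>The measure on the boundary of the tetrablock\<close>

lemma tetra_map_borel: "tetra_map \<in> borel_measurable borel"
proof -
  have "tetra_map = (\<lambda>z. \<chi> i. if i = 1 then z $ 1 else if i = 2 then z $ 2
      else z $ 1 * z $ 2 - (z $ 3)\<^sup>2)"
    by (auto simp: fun_eq_iff vec_eq_iff forall_3 tetra_map_def)
  moreover have "continuous_on UNIV \<dots>"
  proof (rule continuous_on_vec_lambda)
    fix i :: 3
    consider "i = 1" | "i = 2" | "i = 3" using exhaust_3 by blast
    then show "continuous_on UNIV (\<lambda>z :: complex ^ 3. if i = 1 then z $ 1 else if i = 2 then z $ 2
        else z $ 1 * z $ 2 - (z $ 3)\<^sup>2)"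
      by cases (auto intro!: continuous_intros)
  qed
  ultimately show ?thesis by (metis borel_measurable_continuous_onI)
qed

lemma vec_nth_borel: "(\<lambda>z :: complex ^ 3. z $ i) \<in> borel_measurable borel"
  by (intro borel_measurable_continuous_onI continuous_intros)

lemma smult_borel: "((*s) c :: complex ^ 3 \<Rightarrow> complex ^ 3) \<in> borel_measurable borel"
proof -
  have "(\<lambda>z :: complex ^ 3. \<chi> i. c * z $ i) \<in> borel_measurable borel"
    by (intro borel_measurable_continuous_onI continuous_intros)
  moreover have "(*s) c = (\<lambda>z :: complex ^ 3. \<chi> i. c * z $ i)"
    by (auto simp: fun_eq_iff vec_eq_iff)
  ultimately show ?thesis by simp
qed

lemma
  assumes "invariant_probability \<Theta>"
  shows space_invariant_probability: "space \<Theta> = shilov_cartan_II"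
    and measurable_invariant_probability:
      "f \<in> measurable \<Theta> N \<longleftrightarrow> f \<in> measurable (restrict_space borel shilov_cartan_II) N"
proof -
  have s: "sets \<Theta> = sets (restrict_space borel shilov_cartan_II)"
    using assms by (simp add: invariant_probability_def)
  show "space \<Theta> = shilov_cartan_II"
    using sets_eq_imp_space_eq[OF s] by (simp add: space_restrict_space)
  show "f \<in> measurable \<Theta> N \<longleftrightarrow> f \<in> measurable (restrict_space borel shilov_cartan_II) N"
    using measurable_cong_sets[OF s refl] by blast
qed

lemma tetra_map_measurable:
  assumes "invariant_probability \<Theta>"
  shows "tetra_map \<in> measurable \<Theta> (restrict_space borel shilov_tetrablock)"
  unfolding measurable_invariant_probability[OF assms]
  by (intro measurable_restrict_space2 measurable_restrict_space1 tetra_map_borel)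
    (auto simp: space_restrict_space tetra_map_shilov)

lemma tetra_jac_measurable:
  assumes "invariant_probability \<Theta>"
  shows "tetra_jac \<in> borel_measurable \<Theta>"
  unfolding measurable_invariant_probability[OF assms]
  by (intro measurable_restrict_space1)
    (simp only: tetra_jac_eq[abs_def], intro borel_measurable_times borel_measurable_const
      vec_nth_borel)

lemma space_tetra_measure: "space (tetra_measure \<Theta>) = shilov_tetrablock"
  by (simp add: tetra_measure_def space_restrict_space)

lemma nth3_measurable: "(\<lambda>x. x $ 3) \<in> borel_measurable (tetra_measure \<Theta>)"
  using measurable_restrict_space1[OF vec_nth_borel, of 3 shilov_tetrablock]
  by (simp add: tetra_measure_def)

lemma tetra_const_nonneg: "tetra_const \<Theta> \<ge> 0"
  by (simp add: tetra_const_def)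

lemma integral_tetra_measure:
  fixes F :: "complex ^ 3 \<Rightarrow> complex"
  assumes \<Theta>: "invariant_probability \<Theta>"
    and F: "F \<in> borel_measurable (restrict_space borel shilov_tetrablock)"
  shows "(\<integral>x. F x \<partial>tetra_measure \<Theta>)
    = (\<integral>z. ((norm (tetra_jac z))\<^sup>2 / tetra_const \<Theta>) *\<^sub>R F (tetra_map z) \<partial>\<Theta>)"
proof -
  note tetra_map_measurable[OF \<Theta>, measurable] tetra_jac_measurable[OF \<Theta>, measurable] F[measurable]
  show ?thesis
    unfolding tetra_measure_def
    by (subst integral_distr, simp, simp, subst integral_density)
      (auto simp: tetra_const_nonneg)
qed

lemma finite_tetra_measure:
  assumes \<Theta>: "invariant_probability \<Theta>"
  shows "finite_measure (tetra_measure \<Theta>)"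
proof -
  interpret prob_space \<Theta> using \<Theta> by (simp add: invariant_probability_def)
  note tetra_map_measurable[OF \<Theta>, measurable] tetra_jac_measurable[OF \<Theta>, measurable]
  have "(\<integral>\<^sup>+z. ennreal ((norm (tetra_jac z))\<^sup>2 / tetra_const \<Theta>) \<partial>\<Theta>)
      \<le> (\<integral>\<^sup>+z. ennreal (4 / tetra_const \<Theta>) \<partial>\<Theta>)"
  proof (intro nn_integral_mono ennreal_leI divide_right_mono tetra_const_nonneg)
    fix z assume "z \<in> space \<Theta>"
    then have "norm (z $ 3) \<le> 1"
      by (simp add: space_invariant_probability[OF \<Theta>] shilov_cartan_II_det(4))
    then show "(norm (tetra_jac z))\<^sup>2 \<le> 4"
      using power_mono[of "norm (z $ 3)" 1 2]
      by (simp add: tetra_jac_eq norm_mult power_mult_distrib)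
  qed
  also have "\<dots> < \<infinity>" by (simp add: emeasure_space_1)
  finally have "emeasure (density \<Theta> (\<lambda>z. ennreal ((norm (tetra_jac z))\<^sup>2 / tetra_const \<Theta>)))
      (space \<Theta>) \<noteq> \<infinity>"
    by (simp add: emeasure_density cong: nn_integral_cong)
  then have "finite_measure (density \<Theta> (\<lambda>z. ennreal ((norm (tetra_jac z))\<^sup>2 / tetra_const \<Theta>)))"
    by (intro finite_measureI) simp
  then show ?thesis
    unfolding tetra_measure_def by (rule finite_measure.finite_measure_distr) simp
qed

lemma integral_rotate:
  fixes F :: "complex ^ 3 \<Rightarrow> complex"
  assumes \<Theta>: "invariant_probability \<Theta>" and c: "norm c = 1" and F: "F \<in> borel_measurable \<Theta>"
  shows "(\<integral>z. F (c *s z) \<partial>\<Theta>) = (\<integral>z. F z \<partial>\<Theta>)"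
proof -
  let ?N = "restrict_space borel shilov_cartan_II"
  have "distr \<Theta> ?N ((*s) c) = \<Theta>"
    using \<Theta> rotation_in_linear_automorphisms[OF c] by (auto simp: invariant_probability_def)
  moreover have "(*s) c \<in> measurable \<Theta> ?N"
    unfolding measurable_invariant_probability[OF \<Theta>]
    by (intro measurable_restrict_space2 measurable_restrict_space1 smult_borel)
      (auto simp: space_restrict_space shilov_rotate[OF c])
  moreover have "F \<in> borel_measurable ?N"
    using F unfolding measurable_invariant_probability[OF \<Theta>] .
  ultimately show ?thesis by (metis integral_distr)
qed

text \<open>
  A rotation by \<open>c\<close> preserves \<open>\<Theta>\<close> and the weight, and multiplies the determinant by \<open>c\<^sup>2\<close>. For \<open>c\<close>
  with \<open>c\<^sup>2\<^sup>n = -1\<close> the moment is therefore its own negative.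
\<close>

lemma tetra_measure_moments:
  assumes \<Theta>: "invariant_probability \<Theta>" and n: "n \<ge> 1"
  shows "(\<integral>x. (x $ 3) ^ n \<partial>tetra_measure \<Theta>) = 0"
proof -
  define D where "D = (\<lambda>z. ((norm (tetra_jac z))\<^sup>2 / tetra_const \<Theta>) *\<^sub>R (tetra_map z $ 3) ^ n)"
  define c where "c = cis (pi / (2 * real n))"
  have c: "norm c = 1" by (simp add: c_def)
  have "c ^ (2 * n) = cis (real (2 * n) * (pi / (2 * real n)))"
    unfolding c_def by (rule Complex.DeMoivre)
  also have "\<dots> = - 1" using n by simp
  finally have c2n: "(c\<^sup>2) ^ n = - 1" by (simp add: power_mult)
  have m: "(\<lambda>x :: complex ^ 3. (x $ 3) ^ n) \<in> borel_measurable (restrict_space borel shilov_tetrablock)"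
    by (intro measurable_restrict_space1 borel_measurable_power vec_nth_borel)
  note tetra_jac_measurable[OF \<Theta>, measurable]
  have "D \<in> borel_measurable \<Theta>"
    using measurable_compose[OF tetra_map_measurable[OF \<Theta>] m] unfolding D_def by measurable
  from integral_rotate[OF \<Theta> c this]
  have "(\<integral>z. D (c *s z) \<partial>\<Theta>) = (\<integral>z. D z \<partial>\<Theta>)" .
  moreover have "D (c *s z) = (- 1) * D z" for z
  proof -
    have "tetra_map (c *s z) $ 3 = c\<^sup>2 * tetra_map z $ 3"
      by (simp add: tetra_map_def algebra_simps power2_eq_square)
    then show ?thesis
      by (simp add: D_def tetra_jac_eq norm_mult c power_mult_distrib c2n)
  qed
  ultimately have "(\<integral>z. D z \<partial>\<Theta>) = 0" by simp
  then show ?thesis by (simp add: integral_tetra_measure[OF \<Theta> m] D_def)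
qed

section \<open>Multiplication by the third coordinate\<close>

text \<open>
  At the points \<open>r z\<close> with \<open>z\<close> in the Shilov boundary, the determinant has
  the constant modulus \<open>r\<^sup>2 < 1\<close>; so none of the integrals in the Hardy norm grows.
\<close>

lemma hardy_tetrablock_mult_nth3:
  assumes \<Theta>: "invariant_probability \<Theta>" and f: "f \<in> hardy_tetrablock \<Theta>"
  shows "(\<lambda>x. x $ 3 * f x) \<in> hardy_tetrablock \<Theta>"
proof -
  have "holomorphic_several (\<lambda>x. x $ 3 * f x) tetrablock"
    unfolding holomorphic_several_def
  proof
    fix z assume "z \<in> tetrablock"
    then obtain f' where f': "(f has_derivative f') (at z)" "Vector_Spaces.linear (*s) (*) f'"
      using f by (auto simp: hardy_tetrablock_def holomorphic_several_def)
    have "((\<lambda>x. x $ 3 * f x) has_derivative (\<lambda>h. z $ 3 * f' h + h $ 3 * f z)) (at z)"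
      by (intro has_derivative_mult f' bounded_linear_imp_has_derivative bounded_linear_vec_nth)
    moreover have "Vector_Spaces.linear (*s) (*) (\<lambda>h. z $ 3 * f' h + h $ 3 * f z)"
      using f'(2) unfolding Vector_Spaces.linear_iff by (auto simp: algebra_simps)
    ultimately show "\<exists>f'. ((\<lambda>x. x $ 3 * f x) has_derivative f') (at z)
        \<and> Vector_Spaces.linear (*s) (*) f'" by blast
  qed
  moreover have "hardy_norm \<Theta> (\<lambda>z. tetra_jac z * (tetra_map z $ 3 * f (tetra_map z)))
      \<le> hardy_norm \<Theta> (\<lambda>z. tetra_jac z * f (tetra_map z))"
    unfolding hardy_norm_def
  proof (rule SUP_mono)
    fix r :: real assume r: "r \<in> {0<..<1}"
    let ?F = "\<lambda>z. tetra_jac (r *\<^sub>R z) * f (tetra_map (r *\<^sub>R z))"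
    let ?G = "\<lambda>z. tetra_jac (r *\<^sub>R z) * (tetra_map (r *\<^sub>R z) $ 3 * f (tetra_map (r *\<^sub>R z)))"
    have "(\<integral>z. (norm (?G z))\<^sup>2 \<partial>\<Theta>) = (\<integral>z. (r\<^sup>2)\<^sup>2 * (norm (?F z))\<^sup>2 \<partial>\<Theta>)"
    proof (intro Bochner_Integration.integral_cong refl)
      fix z assume "z \<in> space \<Theta>"
      then have "norm (z $ 1 * z $ 2 - (z $ 3)\<^sup>2) = 1"
        by (intro shilov_cartan_II_det(2)) (simp add: space_invariant_probability[OF \<Theta>])
      moreover have "tetra_map (r *\<^sub>R z) $ 3 = of_real (r\<^sup>2) * (z $ 1 * z $ 2 - (z $ 3)\<^sup>2)"
        unfolding tetra_map_def vector_3 vector_scaleR_component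
        by (simp add: scaleR_conv_of_real algebra_simps power2_eq_square)
      ultimately have "norm (tetra_map (r *\<^sub>R z) $ 3) = r\<^sup>2"
        by (simp add: norm_mult norm_power)
      then show "(norm (?G z))\<^sup>2 = (r\<^sup>2)\<^sup>2 * (norm (?F z))\<^sup>2"
        by (simp add: norm_mult power_mult_distrib)
    qed
    also have "\<dots> = (r\<^sup>2)\<^sup>2 * (\<integral>z. (norm (?F z))\<^sup>2 \<partial>\<Theta>)" by simp
    also have "\<dots> \<le> 1 * (\<integral>z. (norm (?F z))\<^sup>2 \<partial>\<Theta>)"
      using r by (intro mult_right_mono) (auto intro!: power_le_one)
    finally have "L2_norm \<Theta> ?G \<le> L2_norm \<Theta> ?F"
      unfolding L2_norm_def by simp
    with r show "\<exists>s\<in>{0<..<1}. ereal (L2_norm \<Theta> ?G)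
        \<le> ereal (L2_norm \<Theta> (\<lambda>z. tetra_jac (s *\<^sub>R z) * f (tetra_map (s *\<^sub>R z))))"
      by auto
  qed
  ultimately show ?thesis
    using f by (auto simp: hardy_tetrablock_def intro: le_less_trans)
qed

lemma radial_limit_mult_nth3:
  assumes "radial_limit \<Theta> (\<lambda>z. tetra_jac z * f (tetra_map z)) (\<lambda>z. tetra_jac z * g (tetra_map z))"
  shows "radial_limit \<Theta> (\<lambda>z. tetra_jac z * (tetra_map z $ 3 * f (tetra_map z)))
    (\<lambda>z. tetra_jac z * (tetra_map z $ 3 * g (tetra_map z)))"
  using assms unfolding radial_limit_def
proof eventually_elim
  case (elim z)
  have "((\<lambda>r. tetra_map (r *\<^sub>R z) $ 3) \<longlongrightarrow> tetra_map (1 *\<^sub>R z) $ 3) (at_left 1)"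
    by (simp only: tetra_map_def vector_3) (intro tendsto_intros)
  then have "((\<lambda>r. tetra_map (r *\<^sub>R z) $ 3 * (tetra_jac (r *\<^sub>R z) * f (tetra_map (r *\<^sub>R z))))
      \<longlongrightarrow> tetra_map z $ 3 * (tetra_jac z * g (tetra_map z))) (at_left 1)"
    using tendsto_mult[OF _ elim] by simp
  then show ?case by (simp add: mult.left_commute)
qed

lemma hardy_boundary_mult_nth3:
  assumes \<Theta>: "invariant_probability \<Theta>" and g: "g \<in> hardy_boundary \<Theta>"
  shows "(\<lambda>x. x $ 3 * g x) \<in> hardy_boundary \<Theta>"
proof -
  obtain f where f: "f \<in> hardy_tetrablock \<Theta>"
    "radial_limit \<Theta> (\<lambda>z. tetra_jac z * f (tetra_map z)) (\<lambda>z. tetra_jac z * g (tetra_map z))"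
    and gL2: "g \<in> L2_space (tetra_measure \<Theta>)"
    using g by (auto simp: hardy_boundary_def)
  have "(\<lambda>x. x $ 3 * g x) \<in> L2_space (tetra_measure \<Theta>)"
    by (rule L2_bounded_mult[OF gL2 nth3_measurable, where B = 1])
      (auto simp: space_tetra_measure shilov_tetrablock_def)
  moreover note hardy_tetrablock_mult_nth3[OF \<Theta> f(1)] radial_limit_mult_nth3[OF f(2)]
  ultimately show ?thesis
    unfolding hardy_boundary_def
    by (intro CollectI conjI bexI[of _ "\<lambda>x. x $ 3 * f x"]) auto
qed

section \<open>Compact Toeplitz operators on the tetrablock\<close>

theorem theorem4p2:
  fixes \<Theta> :: "(complex ^ 3) measure"
    and P :: "(complex ^ 3 \<Rightarrow> complex) \<Rightarrow> (complex ^ 3 \<Rightarrow> complex)"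
    and u :: "complex ^ 3 \<Rightarrow> complex"
  assumes "invariant_probability \<Theta>"
    and "orthogonal_projection (tetra_measure \<Theta>) (hardy_boundary \<Theta>) P"
    and "u \<in> Linf_space (tetra_measure \<Theta>)"
    and "compact_operator (tetra_measure \<Theta>) (hardy_boundary \<Theta>) (toeplitz P u)"
  shows "\<forall>f\<in>hardy_boundary \<Theta>. AE x in tetra_measure \<Theta>. toeplitz P u f x = 0"
proof
  fix f assume f: "f \<in> hardy_boundary \<Theta>"
  show "AE x in tetra_measure \<Theta>. toeplitz P u f x = 0"
  proof (rule compact_toeplitz_eq_0[where w = "\<lambda>x. x $ 3", OF finite_tetra_measure[OF assms(1)]
        nth3_measurable _ tetra_measure_moments[OF assms(1)] _
        hardy_boundary_mult_nth3[OF assms(1)] assms(2,3,4) f])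
    show "norm (x $ 3) = 1" if "x \<in> space (tetra_measure \<Theta>)" for x
      using that by (simp add: space_tetra_measure shilov_tetrablock_def)
    show "hardy_boundary \<Theta> \<subseteq> L2_space (tetra_measure \<Theta>)"
      by (auto simp: hardy_boundary_def)
  qed
qed

end
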